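(* Let $p\in[5,59]$ be a prime, let $G=\langle g\rangle$ be a cyclic group of order $p$ (written additively), and let $S=g^2\cdot(x_1g)\cdot(x_2g)\cdot(x_3g)$ be a minimal zero-sum sequence over $G$, where $x_1,x_2,x_3$ are integers with $2\le x_1\le x_2\le x_3\le p-3$. Then $\operatorname{ind}(S)=2$ if and only if one of the following conditions holds: (1) $x_1=\frac{p-1}{2}$, $x_2=\frac{p+3}{2}$, $x_3=p-3$; (2) $p=17$ and $x_1=8$, $x_2=11$, $x_3=13$; (3) $p=19$ and $x_1=6$, $x_2=14$, $x_3=16$; (4) $p=19$ and $x_1=9$, $x_2=12$, $x_3=15$; (5) $p=23$ and $x_1=11$, $x_2=15$, $x_3=18$; (6) $p=23$ and $x_1=9$, $x_2=15$, $x_3=20$; (7) $p=29$ and $x_1=14$, $x_2=19$, $x_3=23$.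
   Context: Let $G$ be a finite cyclic group written additively. A sequence over $G$ is an element of the free abelian monoid $\mathcal F(G)$ with basis $G$, i.e. a finite multiset of elements of $G$ written multiplicatively; $g^2$ means that the term $g$ is taken twice. $S$ is a zero-sum sequence if the sum of its terms is $0$; it is a minimal zero-sum sequence if in addition no proper nontrivial (nonempty) subsequence has sum $0$. Index: for each generator $g$ of $G$ one can write $S=(n_1g)\cdot\ldots\cdot(n_lg)$ with unique $n_1,\ldots,n_l\in[1,\operatorname{ord}(g)]$, and one sets $\|S\|_g=\frac{n_1+\cdots+n_l}{\operatorname{ord}(g)}$; then $\operatorname{ind}(S)=\min\{\|S\|_g : g\in G,\ G=\langle g\rangle\}$. *)

theory Defs
  imports "HOL-Algebra.Algebra" "HOL-Library.Multiset" "HOL-Computational_Algebra.Primes"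
begin

(* HOL-Algebra writes groups multiplicatively.  The additively written group of the text is a
   group G in that sense: its sum is the operation of G, 0 is \<one>, and n g is g [^] n.
   A sequence over G is a finite multiset of elements of carrier G. *)

definition seq_over :: "('a, 'b) monoid_scheme \<Rightarrow> 'a multiset \<Rightarrow> bool" where
  "seq_over G S \<longleftrightarrow> set_mset S \<subseteq> carrier G"

(* finprod ranges over a set, so a term of multiplicity k contributes its k-th power;
   meaningful for G commutative and S over G. *)
definition seq_sum :: "('a, 'b) monoid_scheme \<Rightarrow> 'a multiset \<Rightarrow> 'a" where
  "seq_sum G S = finprod G (\<lambda>x. x [^]\<^bsub>G\<^esub> count S x) (set_mset S)"

definition zero_sum_seq :: "('a, 'b) monoid_scheme \<Rightarrow> 'a multiset \<Rightarrow> bool" where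
  "zero_sum_seq G S \<longleftrightarrow> seq_over G S \<and> seq_sum G S = \<one>\<^bsub>G\<^esub>"

definition minimal_zero_sum_seq :: "('a, 'b) monoid_scheme \<Rightarrow> 'a multiset \<Rightarrow> bool" where
  "minimal_zero_sum_seq G S \<longleftrightarrow>
     zero_sum_seq G S \<and> (\<forall>T. T \<subset># S \<and> T \<noteq> {#} \<longrightarrow> \<not> zero_sum_seq G T)"

definition group_generator :: "('a, 'b) monoid_scheme \<Rightarrow> 'a \<Rightarrow> bool" where
  "group_generator G g \<longleftrightarrow> g \<in> carrier G \<and> generate G {g} = carrier G"

definition coeff_wrt :: "('a, 'b) monoid_scheme \<Rightarrow> 'a \<Rightarrow> 'a \<Rightarrow> nat" where
  "coeff_wrt G g a = (THE n. n \<in> {1..group.ord G g} \<and> a = g [^]\<^bsub>G\<^esub> n)"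

definition seq_norm :: "('a, 'b) monoid_scheme \<Rightarrow> 'a \<Rightarrow> 'a multiset \<Rightarrow> real" where
  "seq_norm G g S = real (\<Sum>a\<in>#S. coeff_wrt G g a) / real (group.ord G g)"

(* For G finite cyclic the set below is finite and nonempty, so Min is a genuine minimum. *)
definition seq_index :: "('a, 'b) monoid_scheme \<Rightarrow> 'a multiset \<Rightarrow> real" where
  "seq_index G S = Min {seq_norm G g S | g. group_generator G g}"

end

theory Submission
  imports Defs
begin

text \<open>
  The index of a sequence over a finite cyclic group is a question about residues of integers.
  Fix a generator \<open>g\<close> of a group of order \<open>n\<close> and write the terms as \<open>g\<close> to the powers
  \<open>xs\<close>. A generator \<open>h\<close> satisfies \<open>g = h [^] k\<close> for exactly one class \<open>k\<close> of units modulo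
  \<open>n\<close>, and every unit class arises in this way; the coefficients with respect to \<open>h\<close>
  are the representatives in \<open>{1..n}\<close> of the numbers \<open>k * x\<close>. So the index is the least value of
  \<open>scaled_coeff_sum n xs k / n\<close> over the units \<open>k\<close> (\<open>seq_norms_powers\<close>).

  For the sequences in question \<open>n = p\<close> is prime and \<open>xs = [1, 1, x\<^sub>1, x\<^sub>2, x\<^sub>3]\<close>. That the sequence
  has sum zero makes \<open>\<sigma> = 2 + x\<^sub>1 + x\<^sub>2 + x\<^sub>3\<close> a multiple of \<open>p\<close>, and the bounds on the \<open>x\<^sub>i\<close> leave
  \<open>\<sigma> = p\<close> and \<open>\<sigma> = 2 * p\<close>. In the first case \<open>g\<close> itself shows that the index is at most \<open>1\<close>, and no
  exceptional triple has this sum. In the second case \<open>g\<close> yields the value \<open>2\<close>, so the index is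
  \<open>2\<close> unless some multiplier \<open>k\<close> brings the sum below \<open>2 * p\<close>. Since \<open>\<sigma> = 2 * p\<close>
  determines \<open>x\<^sub>3\<close>, only about a thousand triples exist for all primes together, and
  \<open>exceptional_by_search\<close> looks for such a \<open>k\<close> for each of them by verified rewriting.

  That the family \<open>(p - 1) / 2, (p + 3) / 2, p - 3\<close> survives for every \<open>p\<close> is no accident. Let
  \<open>1 \<le> m \<le> (p - 1) / 2\<close>. For \<open>k = 2 * m\<close> the first three residues are \<open>2 * m\<close>, \<open>2 * m\<close>, \<open>p - m\<close>,
  with sum above \<open>p\<close>. For \<open>k = p - 2 * m\<close> the first four are \<open>p - 2 * m\<close>,
  \<open>p - 2 * m\<close>, \<open>m\<close> and the residue of \<open>- 3 * m\<close>, which is \<open>p - 3 * m\<close> or \<open>2 * p - 3 * m\<close> according to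
  whether \<open>3 * m\<close> is below or above \<open>p\<close>; again the sum exceeds \<open>p\<close>. As the full sum is a multiple of
  \<open>p\<close>, it is at least \<open>2 * p\<close> for every \<open>k\<close>. The six other triples are sporadic.
\<close>

section \<open>Residues and the search for small multipliers\<close>

text \<open>
  Coefficients of group elements lie in \<open>{1..n}\<close>, so the representative of the class of \<open>0\<close> is \<open>n\<close>;
  the shift by one produces this without a case distinction.
\<close>

definition pos_residue :: "int \<Rightarrow> int \<Rightarrow> int" where
  "pos_residue n a = (a - 1) mod n + 1"

lemma pos_residue_bounds: "n > 0 \<Longrightarrow> 1 \<le> pos_residue n a \<and> pos_residue n a \<le> n"
  by (simp add: pos_residue_def add1_zle_eq)

lemma pos_residue_cong: "n dvd pos_residue n a - a"
proof -
  have "pos_residue n a - a = - ((a - 1) div n * n)"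
    using div_mult_mod_eq[of "a - 1" n] unfolding pos_residue_def by linarith
  then show ?thesis by simp
qed

lemma pos_residue_unique:
  assumes "1 \<le> m" "m \<le> n" "n dvd m - a"
  shows "pos_residue n a = m"
proof -
  have "(a - 1) mod n = (m - 1) mod n"
    using assms(3) by (simp add: mod_eq_dvd_iff dvd_diff_commute)
  also have "\<dots> = m - 1" using assms by simp
  finally show ?thesis by (simp add: pos_residue_def)
qed

definition scaled_coeff_sum :: "int \<Rightarrow> int list \<Rightarrow> int \<Rightarrow> int" where
  "scaled_coeff_sum n xs k = (\<Sum>x\<leftarrow>xs. pos_residue n (k * x))"

text \<open>Only the residue class of the multiplier matters, so multipliers in \<open>{0..<n}\<close> suffice.\<close>

lemma scaled_coeff_sum_mod: "scaled_coeff_sum n xs (k mod n) = scaled_coeff_sum n xs k"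
proof -
  have "pos_residue n (k mod n * x) = pos_residue n (k * x)" for x
    unfolding pos_residue_def by (metis mod_diff_left_eq mod_mult_left_eq)
  then show ?thesis by (simp add: scaled_coeff_sum_def)
qed

definition exceptional :: "int \<Rightarrow> int \<Rightarrow> int \<Rightarrow> int \<Rightarrow> bool" where
  "exceptional p a b c \<longleftrightarrow>
     2 * a = p - 1 \<and> 2 * b = p + 3 \<and> c = p - 3
   \<or> (p, a, b, c) \<in> set [(17, 8, 11, 13), (19, 6, 14, 16), (19, 9, 12, 15),
                         (23, 11, 15, 18), (23, 9, 15, 20), (29, 14, 19, 23)]"

text \<open>
  The form of this statement keeps the evaluation by \<open>code_simp\<close> small. The bounds on \<open>b\<close> are what
  \<open>a \<le> b \<le> c \<le> p - 3\<close> means for \<open>c = 2 * p - 2 - a - b\<close>. The function \<open>find\<close> is defined by a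
  conditional, which the simplifier evaluates lazily, so that each search stops at the first
  multiplier that works (usually among the first five); a bounded quantifier would visit all of them.
\<close>

lemma exceptional_by_search:
  "\<forall>p\<in>set [5, 7, 11, 13, 17, 19, 23, 29, 31, 37, 41, 43, 47, 53, 59].
     \<forall>a\<in>set [2..p - 3]. \<forall>b\<in>set [max a (p + 1 - a)..(2 * p - 2 - a) div 2].
       find (\<lambda>k. scaled_coeff_sum p [1, 1, a, b, 2 * p - 2 - a - b] k < 2 * p) [1..p - 1] = None
       \<longleftrightarrow> exceptional p a b (2 * p - 2 - a - b)"
  by code_simp

lemma prime_between_5_and_59:
  fixes p :: nat
  assumes "Factorial_Ring.prime p" "p \<in> {5..59}"
  shows "int p \<in> set [5, 7, 11, 13, 17, 19, 23, 29, 31, 37, 41, 43, 47, 53, 59]"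
proof -
  \<comment> \<open>A composite number below 121 has a prime factor at most 7.\<close>
  have "\<forall>q\<in>set [5..59]. q \<in> set [5, 7, 11, 13, 17, 19, 23, 29, 31, 37, 41, 43, 47, 53, 59]
      \<or> (\<exists>d\<in>set [2, 3, 5, 7 :: int]. d dvd q \<and> d \<noteq> q)"
    by code_simp
  moreover have "int p \<in> set [5..59]" using assms(2) unfolding set_upto by simp
  moreover have "\<not> (\<exists>d\<in>set [2, 3, 5, 7 :: int]. d dvd int p \<and> d \<noteq> int p)"
  proof -
    have "Factorial_Ring.prime (int p)" using assms(1) by simp
    moreover have "Factorial_Ring.prime d" if "d \<in> set [2, 3, 5, 7 :: int]" for d
      using that by auto
    ultimately show ?thesis using primes_dvd_imp_eq by blast
  qed
  ultimately show ?thesis by blast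
qed

lemma scaled_coeff_sum_ge_iff_exceptional:
  fixes p a b c :: int
  assumes "p \<in> set [5, 7, 11, 13, 17, 19, 23, 29, 31, 37, 41, 43, 47, 53, 59]"
    and "2 \<le> a" "a \<le> b" "b \<le> c" "c \<le> p - 3" "2 + a + b + c = 2 * p"
  shows "(\<forall>k\<in>{1..<p}. 2 * p \<le> scaled_coeff_sum p [1, 1, a, b, c] k) \<longleftrightarrow> exceptional p a b c"
proof -
  have c: "c = 2 * p - 2 - a - b" using assms by linarith
  have "a \<in> set [2..p - 3]" using assms by auto
  moreover have "b \<in> set [max a (p + 1 - a)..(2 * p - 2 - a) div 2]" using assms by auto
  ultimately have "find (\<lambda>k. scaled_coeff_sum p [1, 1, a, b, c] k < 2 * p) [1..p - 1] = None
       \<longleftrightarrow> exceptional p a b c"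
    using exceptional_by_search assms(1) unfolding c by blast
  then show ?thesis by (auto simp: find_None_iff not_less)
qed

section \<open>Sequences over a finite cyclic group\<close>

text \<open>
  The sum is defined as a product of powers over the set of distinct terms, which does not follow the
  multiset structure; this recursion does. Splitting off the factor of \<open>a\<close>, which is
  trivial when \<open>a\<close> does not occur in \<open>M\<close>, treats old and new terms alike.
\<close>

lemma (in comm_group) seq_sum_add_mset:
  assumes "a \<in> carrier G" "seq_over G M"
  shows "seq_sum G (add_mset a M) = a \<otimes> seq_sum G M"
proof -
  define B where "B = set_mset M - {a}"
  define f where "f = (\<lambda>x. x [^] count M x)"
  have B: "finite B" "a \<notin> B" "B \<subseteq> carrier G" and fB: "f \<in> B \<rightarrow> carrier G"
    using assms by (auto simp: B_def f_def seq_over_def)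
  have "seq_sum G (add_mset a M) = finprod G (\<lambda>x. x [^] count (add_mset a M) x) (insert a B)"
    unfolding seq_sum_def B_def by (simp add: insert_absorb)
  also have "\<dots> = a [^] Suc (count M a) \<otimes> finprod G (\<lambda>x. x [^] count (add_mset a M) x) B"
    using B assms by (subst finprod_insert) (auto simp: Pi_def subset_iff)
  also have "finprod G (\<lambda>x. x [^] count (add_mset a M) x) B = finprod G f B"
    using B fB by (intro finprod_cong') (auto simp: f_def)
  also have "a [^] Suc (count M a) \<otimes> finprod G f B = a \<otimes> (f a \<otimes> finprod G f B)"
    using assms fB by (simp add: f_def m_ac)
  also have "f a \<otimes> finprod G f B = finprod G f (insert a B)"
    using assms B fB by (subst finprod_insert) (auto simp: f_def)
  also have "finprod G f (insert a B) = seq_sum G M"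
  proof (cases "a \<in># M")
    case True
    then show ?thesis by (simp add: seq_sum_def B_def f_def insert_absorb)
  next
    case False
    then have "f a = \<one>" "B = set_mset M" by (auto simp: f_def B_def not_in_iff)
    then show ?thesis using assms B fB by (subst finprod_insert) (auto simp: seq_sum_def f_def)
  qed
  finally show ?thesis .
qed

context group
begin

lemma group_generator_iff:
  "group_generator G h \<longleftrightarrow> h \<in> carrier G \<and> carrier G = range (\<lambda>k::int. h [^] k)"
  unfolding group_generator_def by (auto simp: generate_pow full_SetCompr_eq)

lemma group_generator_closed: "group_generator G h \<Longrightarrow> h \<in> carrier G"
  by (simp add: group_generator_def)

lemma ord_generator: "group_generator G h \<Longrightarrow> ord h = order G"
  by (simp add: group_generator_def generate_pow_card order_def)

lemma seq_sum_powers: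
  assumes "group_generator G g"
  shows "seq_sum G (mset (map (\<lambda>x::int. g [^] x) xs)) = g [^] sum_list xs"
proof -
  have g: "g \<in> carrier G" using assms by (simp add: group_generator_closed)
  have "cyclic_group G" using assms unfolding cyclic_group group_generator_iff by blast
  then interpret comm_group G by (rule cyclic_imp_abelian_group)
  show ?thesis
  proof (induction xs)
    case Nil
    then show ?case by (simp add: seq_sum_def)
  next
    case (Cons x xs)
    have "seq_over G (mset (map (\<lambda>x::int. g [^] x) xs))"
      using g by (auto simp: seq_over_def)
    with Cons g show ?case by (simp add: seq_sum_add_mset int_pow_mult)
  qed
qed

lemma coeff_wrt_power:
  assumes "group_generator G h" "order G > 0"
  shows "coeff_wrt G h (h [^] (a::int)) = nat (pos_residue (int (order G)) a)"
proof -
  define n where "n = int (order G)"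
  have n: "n > 0" using assms by (simp add: n_def)
  have h: "h \<in> carrier G" "ord h = order G"
    using assms by (auto simp: group_generator_iff ord_generator)
  have pow: "h [^] a = h [^] m \<longleftrightarrow> n dvd int m - a" for m :: nat
    using int_pow_eq[of h a "int m"] h by (simp add: n_def int_pow_int)
  show ?thesis
    unfolding coeff_wrt_def n_def[symmetric] pow h(2)
  proof (rule the_equality)
    show "nat (pos_residue n a) \<in> {1..order G} \<and> n dvd int (nat (pos_residue n a)) - a"
      using pos_residue_bounds[OF n, of a] pos_residue_cong[of n a] by (auto simp: n_def)
  next
    fix m assume "m \<in> {1..order G} \<and> n dvd int m - a"
    then have "pos_residue n a = int m"
      by (intro pos_residue_unique) (auto simp: n_def)
    then show "m = nat (pos_residue n a)" by simp
  qed
qed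

text \<open>
  The change of generator: if \<open>g = h [^] k\<close>, passing from \<open>g\<close> to \<open>h\<close> multiplies all exponents by \<open>k\<close>.
\<close>

lemma seq_norm_powers:
  assumes "group_generator G h" "order G > 0"
  shows "seq_norm G h (mset (map (\<lambda>x::int. (h [^] (k::int)) [^] x) xs))
       = real_of_int (scaled_coeff_sum (int (order G)) xs k) / real (order G)"
proof -
  have h: "h \<in> carrier G" using assms by (simp add: group_generator_closed)
  have nonneg: "pos_residue (int (order G)) a \<ge> 0" for a
    using pos_residue_bounds[of "int (order G)" a] assms(2) by linarith
  have "int (\<Sum>a\<in>#mset (map (\<lambda>x::int. (h [^] k) [^] x) xs). coeff_wrt G h a)
      = scaled_coeff_sum (int (order G)) xs k"
    by (induction xs)
       (simp_all add: scaled_coeff_sum_def int_pow_pow[OF h] coeff_wrt_power[OF assms] nonneg)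
  then show ?thesis
    unfolding seq_norm_def ord_generator[OF assms(1)] by (metis of_int_of_nat_eq)
qed

lemma group_generator_power:
  assumes "group_generator G g" "(g [^] (j::int)) [^] (k::int) = g"
  shows "group_generator G (g [^] j)"
proof -
  have g: "g \<in> carrier G" "carrier G = range (\<lambda>k::int. g [^] k)"
    using assms by (auto simp: group_generator_iff)
  have "g [^] i = (g [^] j) [^] (k * i)" for i :: int
    using assms(2) g(1) by (metis int_pow_pow int_pow_closed)
  then have "range (\<lambda>i::int. g [^] i) \<subseteq> range (\<lambda>i::int. (g [^] j) [^] i)"
    by blast
  moreover have "range (\<lambda>i::int. (g [^] j) [^] i) \<subseteq> carrier G"
    using g(1) by blast
  ultimately show ?thesis
    using g unfolding group_generator_iff by blast
qed

lemma power_power_eq_generator_iff: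
  assumes "group_generator G g"
  shows "(g [^] (j::int)) [^] (k::int) = g \<longleftrightarrow> int (order G) dvd j * k - 1"
proof -
  have g: "g \<in> carrier G" using assms by (simp add: group_generator_closed)
  then show ?thesis
    using int_pow_eq[OF g, of "j * k" 1] ord_generator[OF assms]
    by (simp add: int_pow_pow dvd_diff_commute)
qed

text \<open>
  Generators correspond to units: if \<open>g = h [^] k\<close> and \<open>h = g [^] j\<close>, then \<open>j\<close> and \<open>k\<close> are inverse to
  each other modulo \<open>n\<close>; conversely the inverse \<open>j\<close> of a unit \<open>k\<close> gives the generator \<open>g [^] j\<close>.
\<close>

lemma seq_norms_powers:
  assumes "group_generator G g" "order G = n" "n > 0"
  shows "{seq_norm G h (mset (map (\<lambda>x::int. g [^] x) xs)) | h. group_generator G h}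
       = (\<lambda>k. real_of_int (scaled_coeff_sum (int n) xs k) / real n)
           ` {k \<in> {0..<int n}. coprime k (int n)}"
    (is "?L = ?F ` ?K")
proof (intro equalityI subsetI)
  fix r assume "r \<in> ?L"
  then obtain h where h: "group_generator G h"
    and r: "r = seq_norm G h (mset (map (\<lambda>x::int. g [^] x) xs))" by blast
  obtain k :: int where k: "g = h [^] k" using h assms by (auto simp: group_generator_iff)
  obtain j :: int where j: "h = g [^] j" using h assms by (auto simp: group_generator_iff)
  have "int n dvd j * k - 1"
    using power_power_eq_generator_iff[OF assms(1)] j k assms(2) by metis
  have "coprime k (int n)"
  proof (rule coprimeI)
    fix c assume "c dvd k" "c dvd int n"
    then have "c dvd j * k - (j * k - 1)"
      using \<open>int n dvd j * k - 1\<close> by (blast intro: dvd_diff dvd_mult dvd_trans)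
    then show "is_unit c" by simp
  qed
  then have "k mod int n \<in> ?K" using assms(3) by (simp add: coprime_mod_left_iff)
  moreover have "r = ?F (k mod int n)"
    using seq_norm_powers[OF h, of k xs] assms r k by (simp add: scaled_coeff_sum_mod)
  ultimately show "r \<in> ?F ` ?K" by blast
next
  fix r assume "r \<in> ?F ` ?K"
  then obtain k where k: "coprime k (int n)" and r: "r = ?F k" by blast
  obtain j v where "j * k + v * int n = 1"
    using bezout_int[of k "int n"] k by (metis coprime_iff_gcd_eq_1)
  then have "j * k - 1 = int n * (- v)" by (simp add: algebra_simps)
  then have "int (order G) dvd j * k - 1"
    using assms(2) by (metis dvd_triv_left)
  then have eq: "(g [^] j) [^] k = g"
    using power_power_eq_generator_iff[OF assms(1)] by blast
  then have h: "group_generator G (g [^] j)"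
    using group_generator_power assms(1) by blast
  have "r = seq_norm G (g [^] j) (mset (map (\<lambda>x::int. g [^] x) xs))"
    using seq_norm_powers[OF h, of k xs] assms(2,3) unfolding eq r by simp
  with h show "r \<in> ?L" by blast
qed

lemma seq_index_powers_prime:
  assumes "group_generator G g" "order G = p" "Factorial_Ring.prime p"
  shows "seq_index G (mset (map (\<lambda>x::int. g [^] x) xs))
       = Min ((\<lambda>k. real_of_int (scaled_coeff_sum (int p) xs k) / real p) ` {1..<int p})"
proof -
  have p: "Factorial_Ring.prime (int p)" "int p > 1" using assms(3) prime_gt_1_nat by auto
  have "coprime k (int p) \<longleftrightarrow> k \<noteq> 0" if "k \<in> {0..<int p}" for k
    using that p by (metis atLeastLessThan_iff coprime_0_left_iff coprime_commute
        prime_imp_coprime not_prime_unit order_le_less zdvd_not_zless)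
  then have "{k \<in> {0..<int p}. coprime k (int p)} = {1..<int p}" by auto
  then show ?thesis
    unfolding seq_index_def using seq_norms_powers[OF assms(1,2)] p by simp
qed

end

section \<open>The classification\<close>

theorem proposition2p3:
  fixes G :: "('a, 'b) monoid_scheme"
    and g :: 'a
    and p :: nat
    and x\<^sub>1 x\<^sub>2 x\<^sub>3 :: int
    and S :: "'a multiset"
  assumes "Factorial_Ring.prime p" and "p \<in> {5..59}"
    and "group G" and "order G = p" and "group_generator G g"
    and "2 \<le> x\<^sub>1" and "x\<^sub>1 \<le> x\<^sub>2" and "x\<^sub>2 \<le> x\<^sub>3" and "x\<^sub>3 \<le> int p - 3"
    and "S = {#g, g, g [^]\<^bsub>G\<^esub> x\<^sub>1, g [^]\<^bsub>G\<^esub> x\<^sub>2, g [^]\<^bsub>G\<^esub> x\<^sub>3#}"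
    and "minimal_zero_sum_seq G S"
  shows "seq_index G S = 2 \<longleftrightarrow>
      (real_of_int x\<^sub>1 = (real p - 1) / 2 \<and> real_of_int x\<^sub>2 = (real p + 3) / 2 \<and> x\<^sub>3 = int p - 3)
    \<or> (p = 17 \<and> x\<^sub>1 = 8 \<and> x\<^sub>2 = 11 \<and> x\<^sub>3 = 13)
    \<or> (p = 19 \<and> x\<^sub>1 = 6 \<and> x\<^sub>2 = 14 \<and> x\<^sub>3 = 16)
    \<or> (p = 19 \<and> x\<^sub>1 = 9 \<and> x\<^sub>2 = 12 \<and> x\<^sub>3 = 15)
    \<or> (p = 23 \<and> x\<^sub>1 = 11 \<and> x\<^sub>2 = 15 \<and> x\<^sub>3 = 18)
    \<or> (p = 23 \<and> x\<^sub>1 = 9 \<and> x\<^sub>2 = 15 \<and> x\<^sub>3 = 20)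
    \<or> (p = 29 \<and> x\<^sub>1 = 14 \<and> x\<^sub>2 = 19 \<and> x\<^sub>3 = 23)"
    (is "_ \<longleftrightarrow> ?R")
proof -
  interpret group G by fact
  define xs where "xs = [1, 1, x\<^sub>1, x\<^sub>2, x\<^sub>3]"
  define F where "F = scaled_coeff_sum (int p) xs"
  define \<sigma> where "\<sigma> = 2 + x\<^sub>1 + x\<^sub>2 + x\<^sub>3"
  have p: "5 \<le> int p" using assms(2) by simp
  have g: "g \<in> carrier G" using assms(5) by (rule group_generator_closed)
  have S: "S = mset (map (\<lambda>x::int. g [^]\<^bsub>G\<^esub> x) xs)"
    using g by (simp add: assms(10) xs_def)
  have R: "?R \<longleftrightarrow> exceptional (int p) x\<^sub>1 x\<^sub>2 x\<^sub>3"
  proof -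
    have half: "real_of_int x = real_of_int y / 2 \<longleftrightarrow> 2 * x = y" for x y
      by linarith
    show ?thesis
      using half[of x\<^sub>1 "int p - 1"] half[of x\<^sub>2 "int p + 3"] by (simp add: exceptional_def)
  qed
  have "g [^]\<^bsub>G\<^esub> sum_list xs = \<one>\<^bsub>G\<^esub>"
    using assms(11) unfolding S minimal_zero_sum_seq_def zero_sum_seq_def
    by (simp only: seq_sum_powers[OF assms(5)])
  then have "int p dvd \<sigma>"
    using int_pow_eq_id[OF g] ord_generator[OF assms(5)] assms(4)
    by (simp add: xs_def \<sigma>_def add.assoc)
  then obtain m where m: "\<sigma> = int p * m" by blast
  have "0 < int p * m" "int p * m < int p * 3"
    using assms(6-9) p unfolding m[symmetric] \<sigma>_def by linarith+
  then have "0 < m" "m < 3" using p by (auto simp: zero_less_mult_iff)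
  then have \<sigma>: "\<sigma> = int p \<or> \<sigma> = 2 * int p" using m by (cases "m = 1") auto
  have F1: "F 1 = \<sigma>"
  proof -
    have "pos_residue (int p) x = x" if "1 \<le> x" "x \<le> int p" for x
      using that by (intro pos_residue_unique) auto
    then show ?thesis
      using assms(6-9) p by (simp add: F_def scaled_coeff_sum_def xs_def \<sigma>_def)
  qed
  let ?V = "(\<lambda>k. real_of_int (F k) / real p) ` {1..<int p}"
  have index: "seq_index G S = Min ?V"
    unfolding S F_def by (rule seq_index_powers_prime) fact+
  have V1: "real_of_int \<sigma> / real p \<in> ?V" using F1 p by force
  show ?thesis
    using \<sigma>
  proof
    assume s: "\<sigma> = int p"
    then have "Min ?V \<le> 1" using V1 p by (intro Min_le) auto
    moreover have "\<not> exceptional (int p) x\<^sub>1 x\<^sub>2 x\<^sub>3"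
      using s assms(6-9) p by (auto simp: \<sigma>_def exceptional_def)
    ultimately show ?thesis unfolding R index by simp
  next
    assume s: "\<sigma> = 2 * int p"
    then have "2 \<in> ?V" using V1 p by simp
    then have "Min ?V = 2 \<longleftrightarrow> (\<forall>v\<in>?V. 2 \<le> v)" by (subst Min_eq_iff) auto
    also have "\<dots> \<longleftrightarrow> (\<forall>k\<in>{1..<int p}. 2 * int p \<le> F k)"
    proof -
      have "2 \<le> real_of_int z / real p \<longleftrightarrow> 2 * int p \<le> z" for z
        using p by (simp add: le_divide_eq) linarith
      then show ?thesis by simp
    qed
    also have "\<dots> \<longleftrightarrow> exceptional (int p) x\<^sub>1 x\<^sub>2 x\<^sub>3"
      unfolding F_def xs_def
      by (intro scaled_coeff_sum_ge_iff_exceptional prime_between_5_and_59 assms)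
         (use s in \<open>simp add: \<sigma>_def\<close>)
    finally show ?thesis unfolding R index .
  qed
qed

end
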